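(* Suppose that $E$ is an equivalence relation on $\omega$ which is complete under $\leq_c^4$ among $\Pi^0_2$ equivalence relations, and let $h$ be any computable $\Pi^0_2$-approximating function for $E$. Then $E$ has infinitely many equivalence classes which are not $\Delta^0_2$ under $h$.
   Context: For equivalence relations $F,E$ on $\omega$, $F\leq_c^4E$ means there is a total computable function mapping each $(x_0,\dots,x_3)\in\omega^4$ to $(y_0,\dots,y_3)\in\omega^4$ with $x_i\,F\,x_j\iff y_i\,E\,y_j$ for all $i<j<4$; $E$ is complete under $\leq_c^4$ among $\Pi^0_2$ equivalence relations if $E$ is a $\Pi^0_2$ subset of $\omega\times\omega$ and $F\leq_c^4E$ for every $\Pi^0_2$ equivalence relation $F$ on $\omega$. A computable $\Pi^0_2$-approximating function for $E$ is a total computable $h:\omega^3\to\omega$ such that for all $x,y$: $x\,E\,y\iff h(x,y,s)=1$ for infinitely many $s$. Under such $h$, an $E$-class $[z]_E$ is $\Delta^0_2$ if for all $x,y\in[z]_E$, $\lim_sh(x,y,s)=1$ (i.e. $h(x,y,s)=1$ for all sufficiently large $s$). *)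

theory Defs
  imports Main
begin

datatype recf =
    Zero
  | Succ
  | Proj nat
  | Comp recf "recf list"
  | PrimRec recf recf
  | Minim recf

inductive eval :: "recf \<Rightarrow> nat list \<Rightarrow> nat \<Rightarrow> bool" where
  eval_Zero: "eval Zero xs 0"
| eval_Succ: "eval Succ (x # xs) (Suc x)"
| eval_Proj: "i < length xs \<Longrightarrow> eval (Proj i) xs (xs ! i)"
| eval_Comp: "list_all2 (\<lambda>g r. eval g xs r) gs ys \<Longrightarrow> eval f ys y \<Longrightarrow> eval (Comp f gs) xs y"
| eval_PrimRec0: "eval f xs y \<Longrightarrow> eval (PrimRec f g) (0 # xs) y"
| eval_PrimRecS: "eval (PrimRec f g) (n # xs) r \<Longrightarrow> eval g (n # r # xs) y
      \<Longrightarrow> eval (PrimRec f g) (Suc n # xs) y"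
| eval_Minim: "eval f (n # xs) 0 \<Longrightarrow> (\<forall>m<n. \<exists>k. eval f (m # xs) (Suc k))
      \<Longrightarrow> eval (Minim f) xs n"

definition computable :: "nat \<Rightarrow> (nat list \<Rightarrow> nat) \<Rightarrow> bool" where
  "computable n f \<longleftrightarrow> (\<exists>t. \<forall>xs. length xs = n \<longrightarrow> eval t xs (f xs))"

definition Pi02 :: "nat rel \<Rightarrow> bool" where
  "Pi02 R \<longleftrightarrow> (\<exists>c. computable 4 c \<and>
     (\<forall>x y. (x, y) \<in> R \<longleftrightarrow> (\<forall>a. \<exists>b. c [x, y, a, b] = 0)))"

text \<open>F \<le>_c^4 E: a total computable map omega^4 \<rightarrow> omega^4 (given by its four
  computable components g 0, ..., g 3) preserving and reflecting the relations
  between all pairs of coordinates.\<close>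
definition c4_reducible :: "nat rel \<Rightarrow> nat rel \<Rightarrow> bool" where
  "c4_reducible F E \<longleftrightarrow> (\<exists>g :: nat \<Rightarrow> nat list \<Rightarrow> nat.
     (\<forall>i<4. computable 4 (g i)) \<and>
     (\<forall>xs. length xs = 4 \<longrightarrow>
        (\<forall>i j. i < j \<and> j < 4 \<longrightarrow> ((xs ! i, xs ! j) \<in> F \<longleftrightarrow> (g i xs, g j xs) \<in> E))))"

definition c4_complete_Pi02 :: "nat rel \<Rightarrow> bool" where
  "c4_complete_Pi02 E \<longleftrightarrow> Pi02 E \<and>
     (\<forall>F. equiv UNIV F \<and> Pi02 F \<longrightarrow> c4_reducible F E)"

definition Pi02_approx :: "nat rel \<Rightarrow> (nat \<Rightarrow> nat \<Rightarrow> nat \<Rightarrow> nat) \<Rightarrow> bool" where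
  "Pi02_approx E h \<longleftrightarrow> computable 3 (\<lambda>xs. h (xs ! 0) (xs ! 1) (xs ! 2)) \<and>
     (\<forall>x y. (x, y) \<in> E \<longleftrightarrow> (\<exists>\<^sub>\<infinity>s. h x y s = 1))"

definition Delta02_class :: "(nat \<Rightarrow> nat \<Rightarrow> nat \<Rightarrow> nat) \<Rightarrow> nat set \<Rightarrow> bool" where
  "Delta02_class h C \<longleftrightarrow> (\<forall>x\<in>C. \<forall>y\<in>C. \<exists>s0. \<forall>s\<ge>s0. h x y s = 1)"

end

theory Submission
  imports Defs "HOL-Library.Nat_Bijection" "HOL-Library.Infinite_Set"
begin

text \<open>Suppose only finitely many classes fail to be \<open>\<Delta>\<^sup>0\<^sub>2\<close> under \<open>h\<close>. Each computable
  candidate for a reduction receives four private elements \<open>x\<^sub>0, x\<^sub>1, x\<^sub>2, x\<^sub>3\<close> with images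
  \<open>y\<^sub>0, y\<^sub>1, y\<^sub>2, y\<^sub>3\<close>. Relate \<open>x\<^sub>0, x\<^sub>1\<close> iff \<open>h y\<^sub>0 y\<^sub>1 s \<noteq> 1\<close> infinitely often: if
  the candidate is a reduction, then \<open>y\<^sub>0\<close> and \<open>y\<^sub>1\<close> are equivalent in a class that is not
  \<open>\<Delta>\<^sup>0\<^sub>2\<close>. Treat \<open>x\<^sub>2, x\<^sub>3\<close> in the same way. Now \<open>y\<^sub>1\<close> and \<open>y\<^sub>2\<close> lie in a finite union
  of classes with known representatives, on which inequivalence is \<open>\<Pi>\<^sup>0\<^sub>2\<close> as well, so \<open>x\<^sub>1, x\<^sub>2\<close>
  can be related iff \<open>y\<^sub>1, y\<^sub>2\<close> are inequivalent.\<close>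

section \<open>Closure properties of computable functions\<close>

lemma computable_cong:
  assumes "computable n f" "\<And>xs. length xs = n \<Longrightarrow> f xs = g xs"
  shows "computable n g"
  using assms unfolding computable_def by metis

lemma computable_nth: "i < n \<Longrightarrow> computable n (\<lambda>xs. xs ! i)"
  unfolding computable_def by (auto intro!: exI[of _ "Proj i"] eval_Proj)

lemma computable_compose:
  assumes "computable (length gs) f" "\<And>g. g \<in> set gs \<Longrightarrow> computable n g"
  shows "computable n (\<lambda>xs. f (map (\<lambda>g. g xs) gs))"
proof -
  obtain t where t: "\<And>xs. length xs = length gs \<Longrightarrow> eval t xs (f xs)"
    using assms(1) unfolding computable_def by blast
  obtain T where T: "\<And>g xs. g \<in> set gs \<Longrightarrow> length xs = n \<Longrightarrow> eval (T g) xs (g xs)"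
    using assms(2) unfolding computable_def by metis
  have "eval (Comp t (map T gs)) xs (f (map (\<lambda>g. g xs) gs))" if "length xs = n" for xs
    by (rule eval_Comp[where ys = "map (\<lambda>g. g xs) gs"])
       (auto simp: list_all2_conv_all_nth intro!: T t that)
  then show ?thesis unfolding computable_def by blast
qed

lemma computable_compose1:
  assumes "computable 1 (\<lambda>xs. f (xs ! 0))" "computable n a"
  shows "computable n (\<lambda>xs. f (a xs))"
  using computable_compose[of "[a]" "\<lambda>xs. f (xs ! 0)" n] assms by simp

lemma computable_compose2:
  assumes "computable 2 (\<lambda>xs. f (xs ! 0) (xs ! 1))" "computable n a" "computable n b"
  shows "computable n (\<lambda>xs. f (a xs) (b xs))"
  using computable_compose[of "[a, b]" "\<lambda>xs. f (xs ! 0) (xs ! 1)" n] assms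
  by (auto simp: numeral_2_eq_2)

lemma computable_compose3:
  assumes "computable 3 (\<lambda>xs. f (xs ! 0) (xs ! 1) (xs ! 2))"
    "computable n a" "computable n b" "computable n c"
  shows "computable n (\<lambda>xs. f (a xs) (b xs) (c xs))"
  using computable_compose[of "[a, b, c]" "\<lambda>xs. f (xs ! 0) (xs ! 1) (xs ! 2)" n] assms
  by (auto simp: numeral_3_eq_3 numeral_2_eq_2)

lemma computable_Suc:
  assumes "computable n a" shows "computable n (\<lambda>xs. Suc (a xs))"
proof (rule computable_compose1[OF _ assms])
  have "eval Succ xs (Suc (xs ! 0))" if "length xs = 1" for xs
    using that by (cases xs) (auto intro: eval_Succ)
  then show "computable 1 (\<lambda>xs. Suc (xs ! 0))"
    unfolding computable_def by blast
qed

lemma computable_const: "computable n (\<lambda>xs. c)"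
proof (induction c)
  case 0
  then show ?case unfolding computable_def by (blast intro: eval_Zero)
qed (rule computable_Suc)

lemma computable_primrec:
  assumes "computable n f" "computable (Suc (Suc n)) g"
  shows "computable (Suc n) (\<lambda>xs. rec_nat (f (tl xs)) (\<lambda>m r. g (m # r # tl xs)) (hd xs))"
proof -
  obtain s where s: "\<And>xs. length xs = n \<Longrightarrow> eval s xs (f xs)"
    using assms(1) unfolding computable_def by blast
  obtain t where t: "\<And>xs. length xs = Suc (Suc n) \<Longrightarrow> eval t xs (g xs)"
    using assms(2) unfolding computable_def by blast
  have "eval (PrimRec s t) (k # xs) (rec_nat (f xs) (\<lambda>m r. g (m # r # xs)) k)"
    if "length xs = n" for k xs
    by (induction k) (auto intro!: eval_PrimRec0 s eval_PrimRecS t simp: that)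
  then have "eval (PrimRec s t) xs (rec_nat (f (tl xs)) (\<lambda>m r. g (m # r # tl xs)) (hd xs))"
    if "length xs = Suc n" for xs
    using that by (cases xs) auto
  then show ?thesis unfolding computable_def by blast
qed

lemma computable_primrec1:
  assumes "computable 2 (\<lambda>xs. g (xs ! 0) (xs ! 1))" "computable n a"
  shows "computable n (\<lambda>xs. rec_nat c g (a xs))"
proof (rule computable_compose1[OF _ assms(2)])
  have "computable (Suc 0) (\<lambda>xs. rec_nat c (\<lambda>m r. g ((m # r # tl xs) ! 0) ((m # r # tl xs) ! 1)) (hd xs))"
    using computable_primrec[OF computable_const[of 0 c]] assms(1)
    unfolding numeral_2_eq_2 by blast
  then show "computable 1 (\<lambda>xs. rec_nat c g (xs ! 0))"
    unfolding One_nat_def by (rule computable_cong) (auto simp: length_Suc_conv)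
qed

lemma computable_primrec2:
  assumes "computable 1 (\<lambda>xs. f (xs ! 0))" "computable 3 (\<lambda>xs. g (xs ! 0) (xs ! 1) (xs ! 2))"
    "computable n a" "computable n b"
  shows "computable n (\<lambda>xs. rec_nat (f (b xs)) (\<lambda>m r. g m r (b xs)) (a xs))"
proof (rule computable_compose2[OF _ assms(3,4)])
  have "computable (Suc 1) (\<lambda>xs. rec_nat (f (tl xs ! 0))
     (\<lambda>m r. g ((m # r # tl xs) ! 0) ((m # r # tl xs) ! 1) ((m # r # tl xs) ! 2)) (hd xs))"
    by (rule computable_primrec[OF assms(1), of "\<lambda>xs. g (xs ! 0) (xs ! 1) (xs ! 2)"])
       (use assms(2) in \<open>simp add: numeral_3_eq_3\<close>)
  then show "computable 2 (\<lambda>xs. rec_nat (f (xs ! 1)) (\<lambda>m r. g m r (xs ! 1)) (xs ! 0))"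
    unfolding Suc_1 by (rule computable_cong) (auto simp: length_Suc_conv numeral_2_eq_2)
qed

lemma computable_add:
  assumes "computable n a" "computable n b"
  shows "computable n (\<lambda>xs. a xs + b xs)"
proof -
  have "rec_nat y (\<lambda>m r. Suc r) x = x + y" for x y :: nat by (induction x) auto
  moreover have "computable n (\<lambda>xs. rec_nat (b xs) (\<lambda>m r. Suc r) (a xs))"
    by (intro computable_primrec2[where f = "\<lambda>x. x" and g = "\<lambda>m r y. Suc r"]
        computable_nth computable_Suc assms) auto
  ultimately show ?thesis by simp
qed

lemma computable_mult:
  assumes "computable n a" "computable n b"
  shows "computable n (\<lambda>xs. a xs * b xs)"
proof -
  have "rec_nat 0 (\<lambda>m r. r + y) x = x * y" for x y :: nat by (induction x) auto
  moreover have "computable n (\<lambda>xs. rec_nat 0 (\<lambda>m r. r + b xs) (a xs))"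
    by (intro computable_primrec2[where f = "\<lambda>x. 0" and g = "\<lambda>m r y. r + y"]
        computable_nth computable_const computable_add assms) auto
  ultimately show ?thesis by simp
qed

lemma computable_diff:
  assumes "computable n a" "computable n b"
  shows "computable n (\<lambda>xs. a xs - b xs)"
proof -
  have pred: "computable 3 (\<lambda>xs. xs ! 1 - 1)"
  proof -
    have "rec_nat 0 (\<lambda>m r. m) x = x - 1" for x :: nat by (induction x) auto
    moreover have "computable 3 (\<lambda>xs. rec_nat 0 (\<lambda>m r. m) (xs ! 1))"
      by (intro computable_primrec1 computable_nth) auto
    ultimately show ?thesis by simp
  qed
  have "rec_nat y (\<lambda>m r. r - 1) x = y - x" for x y :: nat by (induction x) auto
  moreover have "computable n (\<lambda>xs. rec_nat (a xs) (\<lambda>m r. r - 1) (b xs))"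
    by (intro computable_primrec2[where f = "\<lambda>x. x" and g = "\<lambda>m r y. r - 1"]
        computable_nth pred assms) auto
  ultimately show ?thesis by simp
qed

text \<open>Truth is coded by 0, matching the convention \<open>c [x, y, a, b] = 0\<close> in
  \<open>Pi02\<close>.\<close>

definition decidable :: "nat \<Rightarrow> (nat list \<Rightarrow> bool) \<Rightarrow> bool" where
  "decidable n P \<longleftrightarrow> computable n (\<lambda>xs. if P xs then 0 else 1)"

lemma computable_if:
  assumes "decidable n P" "computable n a" "computable n b"
  shows "computable n (\<lambda>xs. if P xs then a xs else b xs)"
proof -
  let ?p = "\<lambda>xs. if P xs then 0 else 1 :: nat"
  \<comment> \<open>Both branches are total, so both can be computed and one selected
    arithmetically.\<close>
  have "computable n (\<lambda>xs. (1 - ?p xs) * a xs + ?p xs * b xs)"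
    by (intro computable_add computable_mult computable_diff computable_const assms
        assms(1)[unfolded decidable_def])
  then show ?thesis by (rule computable_cong) auto
qed

lemma decidable_compose:
  assumes "decidable (length gs) P" "\<And>g. g \<in> set gs \<Longrightarrow> computable n g"
  shows "decidable n (\<lambda>xs. P (map (\<lambda>g. g xs) gs))"
  using computable_compose[of gs "\<lambda>xs. if P xs then 0 else 1" n] assms
  unfolding decidable_def by simp

lemma decidable_le:
  assumes "computable n a" "computable n b"
  shows "decidable n (\<lambda>xs. a xs \<le> b xs)"
proof -
  have "computable n (\<lambda>xs. 1 - (1 - (a xs - b xs)))"
    by (intro computable_diff computable_const assms)
  then show ?thesis
    unfolding decidable_def by (rule computable_cong) auto
qed

lemma decidable_not:
  assumes "decidable n P" shows "decidable n (\<lambda>xs. \<not> P xs)"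
  using computable_if[OF assms computable_const[of n 1] computable_const[of n 0]]
  unfolding decidable_def by (rule computable_cong) auto

lemma decidable_conj:
  assumes "decidable n P" "decidable n Q" shows "decidable n (\<lambda>xs. P xs \<and> Q xs)"
  using computable_if[OF assms(1) assms(2)[unfolded decidable_def] computable_const[of n 1]]
  unfolding decidable_def by (rule computable_cong) auto

lemma decidable_disj:
  assumes "decidable n P" "decidable n Q" shows "decidable n (\<lambda>xs. P xs \<or> Q xs)"
  using computable_if[OF assms(1) computable_const[of n 0] assms(2)[unfolded decidable_def]]
  unfolding decidable_def by (rule computable_cong) auto

lemma decidable_less:
  assumes "computable n a" "computable n b"
  shows "decidable n (\<lambda>xs. a xs < b xs)"
  unfolding less_eq_Suc_le by (intro decidable_le computable_Suc assms)

lemma decidable_eq: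
  assumes "computable n a" "computable n b"
  shows "decidable n (\<lambda>xs. a xs = b xs)"
  unfolding eq_iff by (intro decidable_conj decidable_le assms)

lemma decidable_False: "decidable n (\<lambda>xs. False)"
  unfolding decidable_def by (simp add: computable_const)

text \<open>A fixed finite quantifier unfolds into a disjunction. This allows finitely many numbers,
  chosen noncomputably, to be built into a program as constants.\<close>

lemma decidable_Bex:
  assumes "finite A" "\<And>z. z \<in> A \<Longrightarrow> decidable n (P z)"
  shows "decidable n (\<lambda>xs. \<exists>z\<in>A. P z xs)"
  using assms by (induction A) (simp_all add: decidable_False decidable_disj)

text \<open>Bits let a number serve as a finite set: adding \<open>2 ^ x\<close> inserts a new
  element \<open>x\<close>, and \<open>bit\<close> tests membership.\<close>

lemma computable_bit_ops:
  assumes a: "computable n a"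
  shows computable_power2: "computable n (\<lambda>xs. 2 ^ a xs :: nat)"
    and decidable_bit: "computable n b \<Longrightarrow> decidable n (\<lambda>xs. bit (a xs) (b xs))"
proof -
  have "rec_nat 1 (\<lambda>m r. r + r) x = (2 ^ x :: nat)" for x by (induction x) auto
  moreover have "computable n (\<lambda>xs. rec_nat 1 (\<lambda>m r. r + r) (a xs))"
    by (intro computable_primrec1 computable_nth computable_add a) auto
  ultimately show "computable n (\<lambda>xs. 2 ^ a xs :: nat)" by simp
  have mod2: "computable k (\<lambda>xs. c xs mod 2)" if "computable k c" for k c
  proof -
    have "rec_nat 0 (\<lambda>m r. 1 - r) x = x mod 2" for x :: nat
      by (induction x) (simp_all, presburger)
    moreover have "computable k (\<lambda>xs. rec_nat 0 (\<lambda>m r. 1 - r) (c xs))"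
      by (intro computable_primrec1 computable_nth computable_diff computable_const that) auto
    ultimately show ?thesis by simp
  qed
  have div2: "computable k (\<lambda>xs. c xs div 2)" if "computable k c" for k c
  proof -
    \<comment> \<open>\<open>x div 2\<close> is the number of odd \<open>m\<close> below
      \<open>x\<close>.\<close>
    have "rec_nat 0 (\<lambda>m r. r + m mod 2) x = x div 2" for x :: nat
      by (induction x) (simp_all, presburger)
    moreover have "computable k (\<lambda>xs. rec_nat 0 (\<lambda>m r. r + m mod 2) (c xs))"
      by (intro computable_primrec1 computable_nth computable_add mod2 that) auto
    ultimately show ?thesis by simp
  qed
  assume b: "computable n b"
  have "rec_nat y (\<lambda>m r. r div 2) x = y div 2 ^ x" for x y :: nat
    by (induction x) (auto simp: div_mult2_eq[symmetric] mult.commute)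
  moreover have "computable n (\<lambda>xs. rec_nat (a xs) (\<lambda>m r. r div 2) (b xs))"
    by (intro computable_primrec2[where f = "\<lambda>x. x" and g = "\<lambda>m r y. r div 2"]
        computable_nth div2 a b) auto
  ultimately have shift: "computable n (\<lambda>xs. a xs div 2 ^ b xs)" by simp
  have "decidable n (\<lambda>xs. (a xs div 2 ^ b xs) mod 2 = 1)"
    by (intro decidable_eq mod2 shift computable_const)
  then show "decidable n (\<lambda>xs. bit (a xs) (b xs))"
    by (simp add: bit_iff_odd odd_iff_mod_2_eq_one)
qed

section \<open>Pairing\<close>

definition pair :: "nat \<Rightarrow> nat \<Rightarrow> nat" where "pair a b = prod_encode (a, b)"
definition left :: "nat \<Rightarrow> nat" where "left n = fst (prod_decode n)"
definition right :: "nat \<Rightarrow> nat" where "right n = snd (prod_decode n)"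

lemma left_pair [simp]: "left (pair a b) = a"
  and right_pair [simp]: "right (pair a b) = b"
  and pair_collapse [simp]: "pair (left n) (right n) = n"
  and pair_inject [simp]: "pair a b = pair c d \<longleftrightarrow> a = c \<and> b = d"
  and pair_0_0: "pair 0 0 = 0"
  by (simp_all add: pair_def left_def right_def) (simp add: prod_encode_def)

text \<open>Thus 0 decodes as an endless list of zeros, and \<open>item\<close> past the end of a
  code returns 0.\<close>

lemma left_0 [simp]: "left 0 = 0" and right_0 [simp]: "right 0 = 0"
  by (metis left_pair pair_0_0, metis right_pair pair_0_0)

lemma computable_pairing:
  assumes "computable n a"
  shows computable_pair: "computable n b \<Longrightarrow> computable n (\<lambda>xs. pair (a xs) (b xs))"
    and computable_left: "computable n (\<lambda>xs. left (a xs))"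
    and computable_right: "computable n (\<lambda>xs. right (a xs))"
proof -
  have triangle: "computable k (\<lambda>xs. triangle (c xs))" if "computable k c" for k c
  proof -
    have "rec_nat 0 (\<lambda>m r. r + Suc m) x = triangle x" for x by (induction x) auto
    moreover have "computable k (\<lambda>xs. rec_nat 0 (\<lambda>m r. r + Suc m) (c xs))"
      by (intro computable_primrec1 computable_nth computable_add computable_Suc that) auto
    ultimately show ?thesis by simp
  qed
  show "computable n (\<lambda>xs. pair (a xs) (b xs))" if "computable n b"
    unfolding pair_def prod_encode_def prod.case
    by (intro computable_add triangle assms that)
  \<comment> \<open>\<open>d x\<close> is the largest \<open>k\<close> with
    \<open>triangle k\<close> \<le> \<open>x\<close>, that is, the diagonal of the Cantor pairing on
    which \<open>x\<close> lies. It grows by at most one per step.\<close>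
  define d where "d = rec_nat 0 (\<lambda>m r. if triangle (Suc r) \<le> Suc m then Suc r else r)"
  have d_bounds: "triangle (d x) \<le> x \<and> x < triangle (Suc (d x))" for x
    by (induction x) (auto simp: d_def)
  have mono: "x \<le> y \<Longrightarrow> triangle x \<le> triangle y" for x y
    by (induction rule: dec_induct) auto
  have pair_eq: "triangle (left x + right x) + left x = x" for x
    using pair_collapse[of x] by (simp only: pair_def prod_encode_def prod.case)
  have d_eq: "d x = left x + right x" for x
  proof -
    have "\<not> d x < left x + right x" "\<not> left x + right x < d x"
      using d_bounds[of x] pair_eq[of x] mono[of "Suc (d x)" "left x + right x"]
        mono[of "Suc (left x + right x)" "d x"] by auto
    then show ?thesis by simp
  qed
  have d: "computable n (\<lambda>xs. d (a xs))"
    unfolding d_def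
    by (intro computable_primrec1 computable_if decidable_le triangle computable_Suc
        computable_nth assms) auto
  have left_eq: "left x = x - triangle (d x)" for x
    using pair_eq[of x] by (simp add: d_eq)
  show l: "computable n (\<lambda>xs. left (a xs))"
    unfolding left_eq by (intro computable_diff triangle d assms)
  have "right x = d x - left x" for x by (simp add: d_eq)
  then show "computable n (\<lambda>xs. right (a xs))"
    by (simp only:) (intro computable_diff d l)
qed

lemma computable_funpow_right:
  "computable n a \<Longrightarrow> computable n (\<lambda>xs. (right ^^ i) (a xs))"
  by (induction i) (simp_all add: computable_right)

text \<open>No length is stored, so codes are unique only among lists of equal length. In exchange,
  taking the tail is just \<open>right\<close>, and combinators on pairs act directly on coded
  tuples.\<close>

fun enc :: "nat list \<Rightarrow> nat" where
  "enc [] = 0"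
| "enc (x # xs) = pair x (enc xs)"

definition item :: "nat \<Rightarrow> nat \<Rightarrow> nat" where
  "item i w = left ((right ^^ i) w)"

lemma item_simps [simp]:
  "item 0 w = left w"
  "item (Suc i) w = item i (right w)"
  "item (numeral k) w = item (pred_numeral k) (right w)"
  by (simp_all add: item_def funpow_swap1 numeral_eq_Suc)

lemma item_one [simp]: "item 1 w = left (right w)"
  by simp

lemma computable_item: "computable n a \<Longrightarrow> computable n (\<lambda>xs. item i (a xs))"
  unfolding item_def by (intro computable_left computable_funpow_right)

lemmas computability =
  computable_const computable_Suc computable_add computable_mult computable_diff computable_if
  computable_power2 computable_pair computable_left computable_right computable_item
  decidable_le decidable_less decidable_eq decidable_not decidable_conj decidable_disj decidable_bit

section \<open>Inductively generated sets are semidecidable\<close>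

text \<open>Every rule instance \<open>z\<close> has exactly two premises \<open>P z\<close> and
  \<open>Q z\<close>; the axiom 0 is a filler for premises that are absent.\<close>

inductive derivable :: "(nat \<Rightarrow> nat) \<Rightarrow> (nat \<Rightarrow> nat) \<Rightarrow> (nat \<Rightarrow> nat) \<Rightarrow> nat \<Rightarrow> bool"
  for C P Q where
  base: "derivable C P Q 0"
| step: "derivable C P Q (P z) \<Longrightarrow> derivable C P Q (Q z) \<Longrightarrow> derivable C P Q (C z)"

lemma derivable_semidecidable:
  assumes C: "computable 1 (\<lambda>xs. C (xs ! 0))" and P: "computable 1 (\<lambda>xs. P (xs ! 0))"
    and Q: "computable 1 (\<lambda>xs. Q (xs ! 0))"
  obtains D where "decidable 2 (\<lambda>xs. D (xs ! 0) (xs ! 1))"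
    and "\<And>x. derivable C P Q x \<longleftrightarrow> (\<exists>n. D n x)"
proof -
  \<comment> \<open>Stage \<open>n\<close> is a finite set coded by its bits; it tries the rule instance \<open>left n\<close>, so every
    instance is tried infinitely often.\<close>
  define f where "f n s = (if bit s (P (left n)) \<and> bit s (Q (left n)) \<and> \<not> bit s (C (left n))
      then s + 2 ^ C (left n) else s)" for n s :: nat
  \<comment> \<open>The start value 1 has only bit 0 set: stage 0 contains just the axiom.\<close>
  define S where "S = rec_nat 1 f"
  have S_Suc: "bit (S (Suc n)) x \<longleftrightarrow> bit (S n) x \<or>
      (bit (S n) (P (left n)) \<and> bit (S n) (Q (left n)) \<and> x = C (left n))" for n x
  proof (cases "bit (S n) (P (left n)) \<and> bit (S n) (Q (left n)) \<and> \<not> bit (S n) (C (left n))")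
    case True
    then have "S (Suc n) = set_bit (C (left n)) (S n)"
      by (simp add: S_def f_def set_bit_eq)
    then show ?thesis using True by (auto simp: bit_set_bit_iff)
  next
    case False
    then have "S (Suc n) = S n" by (auto simp: S_def f_def)
    then show ?thesis using False by auto
  qed
  have S_mono: "bit (S n) x \<Longrightarrow> n \<le> m \<Longrightarrow> bit (S m) x" for n m x
    by (rotate_tac 1, induction rule: dec_induct) (auto simp: S_Suc)
  have sound: "bit (S n) x \<Longrightarrow> derivable C P Q x" for n x
  proof (induction n arbitrary: x)
    case 0
    then show ?case by (auto simp: S_def bit_1_iff simp del: One_nat_def intro: base)
  next
    case (Suc n)
    then show ?case by (auto simp: S_Suc intro: step)
  qed
  have complete: "\<exists>n. bit (S n) x" if "derivable C P Q x" for x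
    using that
  proof induction
    case base
    have "bit (S 0) 0" by (simp add: S_def bit_0)
    then show ?case ..
  next
    case (step z)
    then obtain m n where "bit (S m) (P z)" "bit (S n) (Q z)" by blast
    \<comment> \<open>Stage \<open>k\<close> tries instance \<open>z\<close> and, being at least
      \<open>m + n\<close>, comes after both premises have entered.\<close>
    moreover define k where "k = pair z (m + n)"
    moreover have "m + n \<le> k" by (simp add: k_def pair_def le_prod_encode_2)
    ultimately have "bit (S k) (P z)" "bit (S k) (Q z)" "left k = z"
      using S_mono by auto
    then have "bit (S (Suc k)) (C z)" by (simp add: S_Suc)
    then show ?case ..
  qed
  have "decidable 2 (\<lambda>xs. bit (S (xs ! 0)) (xs ! 1))"
    unfolding S_def f_def
    by (intro computability computable_primrec1 computable_compose1[OF C]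
        computable_compose1[OF P] computable_compose1[OF Q] computable_nth) auto
  with sound complete show ?thesis using that[of "\<lambda>n x. bit (S n) x"] by blast
qed

section \<open>A universal evaluation relation\<close>

text \<open>Categorical combinators acting on coded tuples: each has rules with at most two premises, and
  every \<open>recf\<close> term translates into them.\<close>

inductive ev :: "nat \<Rightarrow> nat \<Rightarrow> nat \<Rightarrow> bool" where
  ev_zero: "ev (pair 0 0) a 0"
| ev_succ: "ev (pair 1 0) (pair x a) (Suc x)"
| ev_left: "ev (pair 2 0) (pair x a) x"
| ev_right: "ev (pair 3 0) (pair x a) a"
| ev_id: "ev (pair 4 0) a a"
| ev_seq: "ev g a b \<Longrightarrow> ev f b c \<Longrightarrow> ev (pair 5 (pair f g)) a c"
| ev_pair: "ev f a b \<Longrightarrow> ev g a c \<Longrightarrow> ev (pair 6 (pair f g)) a (pair b c)"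
| ev_rec_0: "ev f a y \<Longrightarrow> ev (pair 7 (pair f g)) (pair 0 a) y"
| ev_rec_Suc: "ev (pair 7 (pair f g)) (pair n a) r \<Longrightarrow> ev g (pair n (pair r a)) y \<Longrightarrow>
    ev (pair 7 (pair f g)) (pair (Suc n) a) y"
| ev_search_stop: "ev f (pair n a) 0 \<Longrightarrow> ev (pair 8 f) (pair n a) n"
| ev_search_step: "ev f (pair n a) (Suc k) \<Longrightarrow> ev (pair 8 f) (pair (Suc n) a) m \<Longrightarrow>
    ev (pair 8 f) (pair n a) m"

text \<open>The tag selects the rule; under tags 7 and 8 the recursion counter and the tested value
  (zero or successor) decide which of the two rules applies.\<close>

lemma ev_deterministic: "ev p a r \<Longrightarrow> ev p a r' \<Longrightarrow> r = r'"
proof (induction arbitrary: r' rule: ev.induct)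
  case (ev_seq g a b f c)
  from ev_seq.prems show ?case by cases (use ev_seq.IH in auto)
next
  case (ev_pair f a b g c)
  from ev_pair.prems show ?case by cases (use ev_pair.IH in auto)
next
  case (ev_rec_0 f a y g)
  from ev_rec_0.prems show ?case by cases (use ev_rec_0.IH in auto)
next
  case (ev_rec_Suc f g n a r y)
  from ev_rec_Suc.prems show ?case by cases (use ev_rec_Suc.IH in auto)
next
  case (ev_search_stop f n a)
  from ev_search_stop.prems show ?case by cases (use ev_search_stop.IH in auto)
next
  case (ev_search_step f n a k m)
  from ev_search_step.prems show ?case by cases (use ev_search_step.IH in auto)
qed (erule ev.cases; simp)+

text \<open>\<open>Proj i\<close> discards \<open>i\<close> entries by \<open>right\<close> and then
  takes \<open>left\<close>; a list of programs becomes one program building the coded tuple of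
  results; \<open>Minim\<close> first prepends the counter 0 to the input and then searches.\<close>

fun compile :: "recf \<Rightarrow> nat" and compile_list :: "recf list \<Rightarrow> nat" where
  "compile Zero = pair 0 0"
| "compile Succ = pair 1 0"
| "compile (Proj i) = ((\<lambda>p. pair 5 (pair p (pair 3 0))) ^^ i) (pair 2 0)"
| "compile (Comp f gs) = pair 5 (pair (compile f) (compile_list gs))"
| "compile (PrimRec f g) = pair 7 (pair (compile f) (compile g))"
| "compile (Minim f) = pair 5 (pair (pair 8 (compile f)) (pair 6 (pair (pair 0 0) (pair 4 0))))"
| "compile_list [] = pair 0 0"
| "compile_list (g # gs) = pair 6 (pair (compile g) (compile_list gs))"

lemma ev_compile_list:
  assumes "list_all2 (\<lambda>g y. ev (compile g) a y) gs ys"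
  shows "ev (compile_list gs) a (enc ys)"
  using assms by induction (auto intro: ev.intros)

lemma ev_compile: "eval t xs y \<Longrightarrow> ev (compile t) (enc xs) y"
proof (induction rule: eval.induct)
  case (eval_Proj i xs)
  then show ?case
  proof (induction i arbitrary: xs)
    case 0
    then show ?case by (cases xs) (auto intro: ev.intros)
  next
    case (Suc i)
    then obtain x xs' where "xs = x # xs'" by (cases xs) auto
    with Suc show ?case by (auto intro!: ev_seq ev_right)
  qed
next
  case (eval_Comp xs gs ys f y)
  then have "list_all2 (\<lambda>g y. ev (compile g) (enc xs) y) gs ys"
    by (auto elim: list_all2_mono)
  with eval_Comp.IH show ?case by (auto intro: ev_seq ev_compile_list)
next
  case (eval_Minim f n xs)
  \<comment> \<open>The search succeeds at counter \<open>n\<close>; induction on \<open>k\<close>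
    carries this result backwards until the starting counter 0 is reached.\<close>
  have "ev (pair 8 (compile f)) (pair (n - k) (enc xs)) n" if "k \<le> n" for k
    using that
  proof (induction k)
    case 0
    with eval_Minim show ?case by (auto intro: ev_search_stop)
  next
    case (Suc k)
    then have "n - Suc k < n" "Suc (n - Suc k) = n - k" by auto
    with Suc eval_Minim show ?case by (metis ev_search_step Suc_leD enc.simps(2))
  qed
  from this[of n] show ?case by (auto intro: ev.intros)
qed (auto simp del: One_nat_def intro: ev.intros)

section \<open>Arithmetisation of the evaluation rules\<close>

abbreviation judgement :: "nat \<Rightarrow> nat \<Rightarrow> nat \<Rightarrow> nat" where
  "judgement p a r \<equiv> enc [p, a, r]"

text \<open>\<open>rule z\<close> codes both premises and the conclusion of the instance of a rule of \<open>ev\<close> with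
  parameters \<open>item 1 z, item 2 z, \<dots>\<close>; an absent premise is replaced by \<open>0\<close>, which codes
  the axiom \<open>ev 0 0 0\<close>.\<close>

definition rule :: "nat \<Rightarrow> nat" where
  "rule z = (let k = item 0 z; a = item 1 z; b = item 2 z; c = item 3 z; d = item 4 z;
      e = item 5 z; f = item 6 z in
    if k = 0 then enc [0, 0, judgement (pair 0 0) a 0]
    else if k = 1 then enc [0, 0, judgement (pair 1 0) (pair a b) (Suc a)]
    else if k = 2 then enc [0, 0, judgement (pair 2 0) (pair a b) a]
    else if k = 3 then enc [0, 0, judgement (pair 3 0) (pair a b) b]
    else if k = 4 then enc [0, 0, judgement (pair 4 0) a a]
    else if k = 5 then enc [judgement b c d, judgement a d e, judgement (pair 5 (pair a b)) c e]
    else if k = 6 then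
      enc [judgement a c d, judgement b c e, judgement (pair 6 (pair a b)) c (pair d e)]
    else if k = 7 then enc [judgement a c d, 0, judgement (pair 7 (pair a b)) (pair 0 c) d]
    else if k = 8 then
      enc [judgement (pair 7 (pair a b)) (pair c d) e, judgement b (pair c (pair e d)) f,
        judgement (pair 7 (pair a b)) (pair (Suc c) d) f]
    else if k = 9 then enc [judgement a (pair b c) 0, 0, judgement (pair 8 a) (pair b c) b]
    else if k = 10 then
      enc [judgement a (pair b c) (Suc d), judgement (pair 8 a) (pair (Suc b) c) e,
        judgement (pair 8 a) (pair b c) e]
    else 0)"

lemma computable_rule: "computable n a \<Longrightarrow> computable n (\<lambda>xs. rule (a xs))"
  unfolding rule_def Let_def enc.simps by (intro computability)

abbreviation "ev_derivable \<equiv>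
  derivable (\<lambda>z. item 2 (rule z)) (\<lambda>z. item 0 (rule z)) (\<lambda>z. item 1 (rule z))"

lemma ev_derivable_step:
  assumes "rule z = enc [P, Q, C]" "ev_derivable P" "ev_derivable Q"
  shows "ev_derivable C"
  using derivable.step[of "\<lambda>z. item 2 (rule z)" "\<lambda>z. item 0 (rule z)" "\<lambda>z. item 1 (rule z)" z]
    assms by simp

lemma ev_iff_derivable: "ev p a r \<longleftrightarrow> ev_derivable (judgement p a r)"
proof
  assume "ev p a r"
  then show "ev_derivable (judgement p a r)"
  proof induction
    case (ev_zero a)
    show ?case by (rule ev_derivable_step[of "enc [0, a]" 0 0]) (auto simp: rule_def intro: base)
  next
    case (ev_succ x a)
    show ?case by (rule ev_derivable_step[of "enc [1, x, a]" 0 0]) (auto simp: rule_def intro: base)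
  next
    case (ev_left x a)
    show ?case by (rule ev_derivable_step[of "enc [2, x, a]" 0 0]) (auto simp: rule_def intro: base)
  next
    case (ev_right x a)
    show ?case by (rule ev_derivable_step[of "enc [3, x, a]" 0 0]) (auto simp: rule_def intro: base)
  next
    case (ev_id a)
    show ?case by (rule ev_derivable_step[of "enc [4, a]" 0 0]) (auto simp: rule_def intro: base)
  next
    case (ev_seq g a b f c)
    show ?case
      by (rule ev_derivable_step[OF _ ev_seq.IH, of "enc [5, f, g, a, b, c]"]) (simp add: rule_def)
  next
    case (ev_pair f a b g c)
    show ?case
      by (rule ev_derivable_step[OF _ ev_pair.IH, of "enc [6, f, g, a, b, c]"]) (simp add: rule_def)
  next
    case (ev_rec_0 f a y g)
    show ?case
      by (rule ev_derivable_step[OF _ ev_rec_0.IH base, of "enc [7, f, g, a, y]"])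
         (simp add: rule_def)
  next
    case (ev_rec_Suc f g n a r y)
    show ?case
      by (rule ev_derivable_step[OF _ ev_rec_Suc.IH, of "enc [8, f, g, n, a, r, y]"])
         (simp add: rule_def)
  next
    case (ev_search_stop f n a)
    show ?case
      by (rule ev_derivable_step[OF _ ev_search_stop.IH base, of "enc [9, f, n, a]"])
         (simp add: rule_def)
  next
    case (ev_search_step f n a k m)
    show ?case
      by (rule ev_derivable_step[OF _ ev_search_step.IH, of "enc [10, f, n, a, k, m]"])
         (simp add: rule_def)
  qed
next
  have zero: "ev 0 a 0" for a using ev_zero by (simp add: pair_0_0)
  \<comment> \<open>Soundness is stated for the decoding of an arbitrary number, so that the
    induction also covers the filler 0 and codes \<open>z\<close> with an unknown tag.\<close>
  have "ev (item 0 c) (item 1 c) (item 2 c)" if "ev_derivable c" for c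
    using that
  proof induction
    case base
    show ?case by (simp add: zero)
  next
    case (step z)
    then show ?case
      unfolding rule_def Let_def
      by (auto simp: zero simp del: One_nat_def split: if_splits intro: ev.intros)
  qed
  from this[of "judgement p a r"] show "ev_derivable (judgement p a r) \<Longrightarrow> ev p a r" by simp
qed

text \<open>\<open>T\<close> plays the part of Kleene's T predicate, with the stage of the
  enumeration as the halting witness.\<close>

lemma ev_semidecidable:
  obtains T where "decidable 2 (\<lambda>xs. T (xs ! 0) (xs ! 1))"
    and "\<And>p a r. ev p a r \<longleftrightarrow> (\<exists>n. T n (judgement p a r))"
proof -
  have r: "computable 1 (\<lambda>xs. item i (rule (xs ! 0)))" for i
    by (intro computable_item computable_rule computable_nth) simp
  obtain T where "decidable 2 (\<lambda>xs. T (xs ! 0) (xs ! 1))" "\<And>x. ev_derivable x \<longleftrightarrow> (\<exists>n. T n x)"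
    using derivable_semidecidable[OF r r r] by blast
  then show ?thesis using that by (simp only: ev_iff_derivable)
qed

section \<open>Diagonalisation\<close>

text \<open>Block \<open>e\<close> consists of the numbers \<open>pair i e\<close>, arranged in a path whose \<open>m\<close>-th edge is present
  iff the \<open>\<Pi>\<^sup>0\<^sub>2\<close> condition \<open>q\<close> holds of \<open>m\<close> and the output of program \<open>e\<close> on the first
  four vertices. As a path has no cycles, connectedness is a conjunction of edges, hence \<open>\<Pi>\<^sup>0\<^sub>2\<close>.\<close>

lemma diagonal_equivalence:
  assumes q: "decidable 4 q"
  obtains F where "equiv UNIV F" "Pi02 F"
    and "\<And>E. c4_reducible F E \<Longrightarrow> \<exists>ys. length ys = 4 \<and>
      (\<forall>i<3. (ys ! i, ys ! Suc i) \<in> E \<longleftrightarrow> (\<forall>a. \<exists>b. q [i, enc ys, a, b]))"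
proof -
  obtain T where T: "decidable 2 (\<lambda>xs. T (xs ! 0) (xs ! 1))"
    and ev_iff: "\<And>p a r. ev p a r \<longleftrightarrow> (\<exists>n. T n (judgement p a r))"
    by (rule ev_semidecidable) blast
  define vertices where "vertices e = map (\<lambda>i. pair i e) [0, 1, 2, 3]" for e
  \<comment> \<open>The witness \<open>b\<close> packs a halting stage, a guess of the output and a
    witness for \<open>q\<close>, so halting adds no quantifier. If program \<open>e\<close> has no
    output here, all edges of its block are absent.\<close>
  define edge_at where "edge_at e m a b \<longleftrightarrow>
      T (item 0 b) (judgement e (enc (vertices e)) (item 1 b)) \<and> q [m, item 1 b, a, item 2 b]"
    for e m a b
  define edge where "edge e m \<longleftrightarrow> (\<forall>a. \<exists>b. edge_at e m a b)" for e m
  \<comment> \<open>Edge \<open>m\<close> joins positions \<open>m\<close> and \<open>m + 1\<close>;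
    \<open>btw\<close> picks out the edges on the path from \<open>x\<close> to
    \<open>y\<close>.\<close>
  define btw where "btw x y m \<longleftrightarrow> left x \<le> m \<and> m < left y \<or> left y \<le> m \<and> m < left x" for x y m
  define F where "F = {(x, y). right x = right y \<and> (\<forall>m. btw x y m \<longrightarrow> edge (right x) m)}"

  have btw_trans: "btw x z m \<Longrightarrow> btw x y m \<or> btw y z m" for x y z m
    unfolding btw_def by auto
  have "equiv UNIV F"
  proof (rule equivI)
    show "refl F" by (auto simp: F_def refl_on_def btw_def)
    show "sym F" by (auto simp: F_def sym_def btw_def)
    show "trans F" using btw_trans by (fastforce simp: F_def trans_def)
  qed simp

  moreover have "Pi02 F"
  proof -
    \<comment> \<open>The universal variable codes both the edge and the \<open>a\<close> of
      \<open>edge_at\<close>, merging two universal quantifiers into one.\<close>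
    define c where "c xs \<longleftrightarrow> right (xs ! 0) = right (xs ! 1) \<and>
        (\<not> btw (xs ! 0) (xs ! 1) (left (xs ! 2)) \<or>
          edge_at (right (xs ! 0)) (left (xs ! 2)) (right (xs ! 2)) (xs ! 3))" for xs
    have T': "decidable n (\<lambda>xs. T (f xs) (g xs))" if "computable n f" "computable n g" for n f g
      using decidable_compose[of "[f, g]" "\<lambda>xs. T (xs ! 0) (xs ! 1)" n] T that
      by (auto simp: numeral_2_eq_2)
    have q': "decidable n (\<lambda>xs. q [f xs, g xs, k xs, l xs])"
      if "computable n f" "computable n g" "computable n k" "computable n l" for n f g k l
      using decidable_compose[of "[f, g, k, l]" q n] q that
      by (auto simp: numeral_eq_Suc)
    have "decidable 4 c"
      unfolding c_def btw_def edge_at_def vertices_def enc.simps list.map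
      by (intro computability T' q' computable_nth) auto
    moreover have "(x, y) \<in> F \<longleftrightarrow> (\<forall>a. \<exists>b. c [x, y, a, b])" for x y
    proof -
      have "(x, y) \<in> F \<longleftrightarrow> (\<forall>m a. right x = right y \<and>
          (btw x y m \<longrightarrow> (\<exists>b. edge_at (right x) m a b)))"
        by (auto simp: F_def edge_def)
      also have "\<dots> \<longleftrightarrow> (\<forall>m a. \<exists>b. c [x, y, pair m a, b])"
        by (auto simp: c_def)
      also have "\<dots> \<longleftrightarrow> (\<forall>a. \<exists>b. c [x, y, a, b])"
        by (metis pair_collapse)
      finally show ?thesis .
    qed
    ultimately show ?thesis
      unfolding Pi02_def decidable_def
      by (intro exI[of _ "\<lambda>xs. if c xs then 0 else 1"]) auto
  qed

  moreover have "\<exists>ys. length ys = 4 \<and>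
      (\<forall>i<3. (ys ! i, ys ! Suc i) \<in> E \<longleftrightarrow> (\<forall>a. \<exists>b. q [i, enc ys, a, b]))"
    if "c4_reducible F E" for E
  proof -
    obtain g :: "nat \<Rightarrow> nat list \<Rightarrow> nat" where g: "\<forall>i<4. computable 4 (g i)"
      and red: "\<And>xs i j. length xs = 4 \<Longrightarrow> i < j \<Longrightarrow> j < 4 \<Longrightarrow>
        (xs ! i, xs ! j) \<in> F \<longleftrightarrow> (g i xs, g j xs) \<in> E"
      using \<open>c4_reducible F E\<close> unfolding c4_reducible_def by blast
    from g obtain t where t: "\<And>i xs. i < 4 \<Longrightarrow> length xs = 4 \<Longrightarrow> eval (t i) xs (g i xs)"
      unfolding computable_def by metis
    \<comment> \<open>The four components of the reduction are bundled into a single program, whose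
      index names the block on which it is confronted.\<close>
    define e where "e = compile_list (map t [0..<4])"
    define ys where "ys = map (\<lambda>i. g i (vertices e)) [0..<4]"
    have len: "length (vertices e) = 4" by (simp add: vertices_def)
    have "ev e (enc (vertices e)) (enc ys)"
      unfolding e_def ys_def
      by (rule ev_compile_list)
         (auto simp: list_all2_conv_all_nth e_def[symmetric] intro!: ev_compile t len)
    \<comment> \<open>By determinism the only guess ever confirmed is the true output.\<close>
    then have out: "(\<exists>n. T n (judgement e (enc (vertices e)) Y)) \<longleftrightarrow> Y = enc ys" for Y
      using ev_iff ev_deterministic by metis
    have edge_iff: "edge e m \<longleftrightarrow> (\<forall>a. \<exists>b. q [m, enc ys, a, b])" for m
    proof -
      have "(\<exists>b. edge_at e m a b) \<longleftrightarrow> (\<exists>b. q [m, enc ys, a, b])" for a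
      proof
        assume "\<exists>b. edge_at e m a b"
        then obtain b where b: "T (item 0 b) (judgement e (enc (vertices e)) (item 1 b))"
          "q [m, item 1 b, a, item 2 b]"
          unfolding edge_at_def by blast
        from b(1) have "item 1 b = enc ys" using out by blast
        with b(2) show "\<exists>b. q [m, enc ys, a, b]" by auto
      next
        assume "\<exists>b. q [m, enc ys, a, b]"
        then obtain b where "q [m, enc ys, a, b]" ..
        moreover obtain n where "T n (judgement e (enc (vertices e)) (enc ys))" using out by blast
        ultimately have "edge_at e m a (enc [n, enc ys, b])" by (simp add: edge_at_def)
        then show "\<exists>b. edge_at e m a b" ..
      qed
      then show ?thesis by (simp add: edge_def)
    qed
    have "(ys ! i, ys ! Suc i) \<in> E \<longleftrightarrow> (\<forall>a. \<exists>b. q [i, enc ys, a, b])" if "i < 3" for i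
    proof -
      have nth: "vertices e ! j = pair j e" if "j < 4" for j
        using that by (auto simp: vertices_def less_Suc_eq numeral_eq_Suc)
      have "btw (pair i e) (pair (Suc i) e) m \<longleftrightarrow> m = i" for m
        by (auto simp: btw_def)
      then have "(pair i e, pair (Suc i) e) \<in> F \<longleftrightarrow> edge e i" by (simp add: F_def)
      then show ?thesis
        using red[OF len, of i "Suc i"] that edge_iff nth by (simp add: ys_def)
    qed
    then show ?thesis by (intro exI[of _ ys]) (simp add: ys_def)
  qed
  ultimately show ?thesis using that by blast
qed

text \<open>If each \<open>z\<close> failed at some stage, the maximum of these finitely many stages
  would defeat all of them. This exchanges the quantifiers over stages and over
  \<open>A\<close>.\<close>

lemma antimono_Bex_finite:
  fixes R :: "nat \<Rightarrow> 'a \<Rightarrow> bool"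
  assumes "finite A" and "\<And>a. \<exists>z\<in>A. R a z" and "\<And>a b z. R b z \<Longrightarrow> a \<le> b \<Longrightarrow> R a z"
  shows "\<exists>z\<in>A. \<forall>a. R a z"
proof (rule ccontr)
  assume "\<not> ?thesis"
  then obtain f where f: "\<And>z. z \<in> A \<Longrightarrow> \<not> R (f z) z" by metis
  obtain z where z: "z \<in> A" "R (Max (f ` A)) z" using assms(2) by blast
  moreover have "f z \<le> Max (f ` A)" using assms(1) z by simp
  ultimately show False using f assms(3) by blast
qed

section \<open>Contradiction from finitely many exceptional classes\<close>

theorem theorem4p13:
  fixes E :: "nat rel" and h :: "nat \<Rightarrow> nat \<Rightarrow> nat \<Rightarrow> nat"
  assumes "equiv UNIV E"
    and "c4_complete_Pi02 E"
    and "Pi02_approx E h"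
  shows "infinite {C \<in> UNIV // E. \<not> Delta02_class h C}"
proof
  let ?N = "{C \<in> UNIV // E. \<not> Delta02_class h C}"
  assume fin: "finite ?N"
  have h: "computable 3 (\<lambda>xs. h (xs ! 0) (xs ! 1) (xs ! 2))"
    and E_iff: "\<And>x y. (x, y) \<in> E \<longleftrightarrow> (\<forall>a. \<exists>s\<ge>a. h x y s = 1)"
    using assms(3) by (auto simp: Pi02_approx_def INFM_nat_le)
  have refl: "(x, x) \<in> E" for x using assms(1) by (meson UNIV_I equivE refl_onD)
  have sym: "(x, y) \<in> E \<Longrightarrow> (y, x) \<in> E" for x y using assms(1) by (meson equivE symD)
  have trans: "(x, y) \<in> E \<Longrightarrow> (y, z) \<in> E \<Longrightarrow> (x, z) \<in> E" for x y z
    using assms(1) by (meson equivE transD)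

  define reps where "reps = (\<lambda>C. SOME c. c \<in> C) ` ?N"
  \<comment> \<open>For elements of exceptional classes, inequivalence means being equivalent to the
    two entries of some pair in \<open>L\<close>.\<close>
  define L where "L = {(c, d) \<in> reps \<times> reps. (c, d) \<notin> E}"
  have "finite L"
    by (rule finite_subset[of _ "reps \<times> reps"]) (use fin in \<open>auto simp: L_def reps_def\<close>)
  \<comment> \<open>Here \<open>x\<close> and \<open>y\<close> themselves witness that the class of
    \<open>x\<close> is exceptional.\<close>
  have rep: "\<exists>c\<in>reps. (x, c) \<in> E" if "(x, y) \<in> E" "\<forall>a. \<exists>s\<ge>a. h x y s \<noteq> 1" for x y
  proof -
    have "\<not> Delta02_class h (E `` {x})"
      using that refl[of x] unfolding Delta02_class_def by (metis ImageI singletonI)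
    then have "E `` {x} \<in> ?N" by (simp add: quotientI)
    moreover have "(SOME c. c \<in> E `` {x}) \<in> E `` {x}"
      by (rule someI[of _ x]) (simp add: refl)
    ultimately show ?thesis unfolding reps_def by blast
  qed

  define u where "u i xs = item i (xs ! 1)" for i and xs :: "nat list"
  \<comment> \<open>For the middle edge the last argument packs two stages, since the two
    equivalences with the entries of \<open>z\<close> may be confirmed at different times.\<close>
  define q where "q xs \<longleftrightarrow>
      xs ! 0 = 0 \<and> xs ! 2 \<le> xs ! 3 \<and> h (u 0 xs) (u 1 xs) (xs ! 3) \<noteq> 1 \<or>
      xs ! 0 = 2 \<and> xs ! 2 \<le> xs ! 3 \<and> h (u 2 xs) (u 3 xs) (xs ! 3) \<noteq> 1 \<or>
      xs ! 0 = 1 \<and> xs ! 2 \<le> left (xs ! 3) \<and> xs ! 2 \<le> right (xs ! 3) \<and>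
        (\<exists>z\<in>L. h (u 1 xs) (fst z) (left (xs ! 3)) = 1 \<and> h (u 2 xs) (snd z) (right (xs ! 3)) = 1)"
    for xs
  have "decidable 4 q"
    unfolding q_def u_def
    by (intro computability decidable_Bex \<open>finite L\<close> computable_compose3[OF h] computable_nth) auto
  then obtain F where F: "equiv UNIV F" "Pi02 F"
    and diag: "\<And>E. c4_reducible F E \<Longrightarrow> \<exists>ys. length ys = 4 \<and>
      (\<forall>i<3. (ys ! i, ys ! Suc i) \<in> E \<longleftrightarrow> (\<forall>a. \<exists>b. q [i, enc ys, a, b]))"
    by (rule diagonal_equivalence) blast
  have "c4_reducible F E" using assms(2) F by (simp add: c4_complete_Pi02_def)
  then obtain ys where "length ys = 4"
    and ys: "\<And>i. i < 3 \<Longrightarrow> (ys ! i, ys ! Suc i) \<in> E \<longleftrightarrow> (\<forall>a. \<exists>b. q [i, enc ys, a, b])"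
    using diag by blast
  then obtain y0 y1 y2 y3 where "ys = [y0, y1, y2, y3]"
    by (auto simp: length_Suc_conv numeral_eq_Suc)
  with ys[of 0] ys[of 1] ys[of 2]
  have e01: "(y0, y1) \<in> E \<longleftrightarrow> (\<forall>a. \<exists>s\<ge>a. h y0 y1 s \<noteq> 1)"
    and e23: "(y2, y3) \<in> E \<longleftrightarrow> (\<forall>a. \<exists>s\<ge>a. h y2 y3 s \<noteq> 1)"
    and e12: "(y1, y2) \<in> E \<longleftrightarrow> (\<forall>a. \<exists>b. a \<le> left b \<and> a \<le> right b \<and>
      (\<exists>z\<in>L. h y1 (fst z) (left b) = 1 \<and> h y2 (snd z) (right b) = 1))"
    by (simp_all add: q_def u_def)

  \<comment> \<open>If \<open>x\<close> and \<open>y\<close> were inequivalent,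
    \<open>h x y s\<close> would equal 1 only finitely often, making the right side true and hence
    \<open>x\<close>, \<open>y\<close> equivalent.\<close>
  have alternates: "(x, y) \<in> E \<and> (\<forall>a. \<exists>s\<ge>a. h x y s \<noteq> 1)"
    if "(x, y) \<in> E \<longleftrightarrow> (\<forall>a. \<exists>s\<ge>a. h x y s \<noteq> 1)" for x y
    using that E_iff[of x y] by (meson le_trans nle_le)
  \<comment> \<open>The representative found for the class of \<open>y0\<close> also represents
    \<open>y1\<close>.\<close>
  obtain c where c: "c \<in> reps" "(y1, c) \<in> E"
    using alternates[OF e01] rep sym trans by metis
  obtain d where d: "d \<in> reps" "(y2, d) \<in> E"
    using alternates[OF e23] rep by metis
  have "(y1, y2) \<in> E \<longleftrightarrow> (\<exists>z\<in>L. (y1, fst z) \<in> E \<and> (y2, snd z) \<in> E)"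
  proof
    assume "(y1, y2) \<in> E"
    then have "\<exists>z\<in>L. (\<exists>s\<ge>a. h y1 (fst z) s = 1) \<and> (\<exists>s\<ge>a. h y2 (snd z) s = 1)" for a
      using e12 by metis
    \<comment> \<open>So far the pair \<open>z\<close> may vary with \<open>a\<close>; finiteness of
      \<open>L\<close> fixes one that works for every \<open>a\<close>.\<close>
    then have "\<exists>z\<in>L. \<forall>a. (\<exists>s\<ge>a. h y1 (fst z) s = 1) \<and> (\<exists>s\<ge>a. h y2 (snd z) s = 1)"
      by (rule antimono_Bex_finite[OF \<open>finite L\<close>]) (meson le_trans)
    then show "\<exists>z\<in>L. (y1, fst z) \<in> E \<and> (y2, snd z) \<in> E" using E_iff by metis
  next
    assume "\<exists>z\<in>L. (y1, fst z) \<in> E \<and> (y2, snd z) \<in> E"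
    then obtain z where "z \<in> L" "(y1, fst z) \<in> E" "(y2, snd z) \<in> E" by blast
    then have "\<exists>s t. a \<le> s \<and> a \<le> t \<and> h y1 (fst z) s = 1 \<and> h y2 (snd z) t = 1" for a
      using E_iff by meson
    then show "(y1, y2) \<in> E" unfolding e12 using \<open>z \<in> L\<close> by (metis left_pair right_pair)
  qed
  also have "\<dots> \<longleftrightarrow> (y1, y2) \<notin> E"
  proof
    assume "\<exists>z\<in>L. (y1, fst z) \<in> E \<and> (y2, snd z) \<in> E"
    then obtain c' d' where "(c', d') \<notin> E" "(y1, c') \<in> E" "(y2, d') \<in> E"
      by (auto simp: L_def)
    then show "(y1, y2) \<notin> E" using sym trans by blast
  next
    assume "(y1, y2) \<notin> E"
    \<comment> \<open>Equivalent representatives \<open>c\<close> and \<open>d\<close> would link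
      \<open>y1\<close> to \<open>y2\<close>.\<close>
    then have "(c, d) \<in> L" using c d sym trans unfolding L_def by blast
    then show "\<exists>z\<in>L. (y1, fst z) \<in> E \<and> (y2, snd z) \<in> E" using c d by (auto intro: bexI[of _ "(c, d)"])
  qed
  finally show False by simp
qed

end
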